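(* Let $A\in\mathbb{R}^{p\times m}$ have full column rank, $B\in\mathbb{R}^{n\times q}$ have full row rank, and let $C\in\mathbb{R}^{p\times q}$ and $X^*\in\mathbb{R}^{m\times n}$ satisfy $AX^*B=C$. Let $\Sigma_1\in\mathbb{R}^{p\times p}$ and $\Sigma_2\in\mathbb{R}^{q\times q}$ be symmetric positive definite, and let $S=\zeta\sim N(0,\Sigma_1)$, $P=\eta\sim N(0,\Sigma_2)$, so that $\mu=A^\top S\sim N(0,\Omega_1)$ and $\nu=BP\sim N(0,\Omega_2)$ with $\Omega_1=A^\top\Sigma_1A$, $\Omega_2=B\Sigma_2B^\top$. Then the iterative scheme $$X^{k+1}=X^k+\frac{A^\top\zeta\left(\zeta^\top C\eta-\zeta^\top AX^kB\eta\right)\eta^\top B^\top}{\|\zeta^\top A\|_2^2\,\|B\eta\|_2^2},$$ started from an arbitrary (deterministic) $X^0\in\mathbb{R}^{m\times n}$, satisfies for every $k\ge0$ $$\mathbf{E}\left[\|X^k-X^*\|_F^2\right]\le\rho^k\,\|X^0-X^*\|_F^2,$$ where $$\rho=1-\frac{4}{\pi^2\,\mathrm{Tr}(\Omega_2)\,\mathrm{Tr}(\Omega_1)}\,\lambda_{\min}\left(\Omega_2^\top\otimes\Omega_1\right).$$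
   Context: At each iteration fresh vectors $\zeta\sim N(0,\Sigma_1)$ in $\mathbb{R}^p$ and $\eta\sim N(0,\Sigma_2)$ in $\mathbb{R}^q$ are drawn, independently of each other and of the previous iterations. $\|\cdot\|_F$ is the Frobenius norm, $\otimes$ the Kronecker product, $\lambda_{\min}$ the smallest eigenvalue. *)

theory Defs
  imports "HOL-Probability.Probability"
begin

text \<open>A \<open>p \<times> m\<close> real matrix has type \<open>real^'m^'p\<close>. The library norm on this type is the
  Frobenius norm.\<close>

lemma norm_matrix_eq_frobenius:
  fixes M :: "real^'n^'m"
  shows "norm M = sqrt (\<Sum>i\<in>UNIV. \<Sum>j\<in>UNIV. (M $ i $ j)\<^sup>2)"
  by (simp add: norm_vec_def L2_set_def real_sqrt_pow2 sum_nonneg)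

definition positive_semidefinite :: "real^'n^'n \<Rightarrow> bool" where
  "positive_semidefinite M \<longleftrightarrow> transpose M = M \<and> (\<forall>x. 0 \<le> x \<bullet> (M *v x))"

definition positive_definite :: "real^'n^'n \<Rightarrow> bool" where
  "positive_definite M \<longleftrightarrow> transpose M = M \<and> (\<forall>x. x \<noteq> 0 \<longrightarrow> 0 < x \<bullet> (M *v x))"

definition kronecker :: "real^'b^'a \<Rightarrow> real^'d^'c \<Rightarrow> real^('b \<times> 'd)^('a \<times> 'c)" where
  "kronecker M N = (\<chi> r c. M $ fst r $ fst c * N $ snd r $ snd c)"

definition eigenvalues :: "real^'n^'n \<Rightarrow> real set" where
  "eigenvalues M = {l. \<exists>v. v \<noteq> 0 \<and> M *v v = l *\<^sub>R v}"

text \<open>Meaningful for symmetric matrices, whose set of real eigenvalues is finite and nonempty.\<close>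

definition lambda_min :: "real^'n^'n \<Rightarrow> real" where
  "lambda_min M = Min (eigenvalues M)"

text \<open>The column times row product \<open>u v\<^sup>T\<close>.\<close>

definition outer :: "real^'m \<Rightarrow> real^'n \<Rightarrow> real^'n^'m" where
  "outer u v = (\<chi> i j. u $ i * v $ j)"

text \<open>The law \<open>N(m, v)\<close> on the real line for \<open>v \<ge> 0\<close>; for \<open>v = 0\<close> it is the point mass at \<open>m\<close>.
  The parameter of \<open>normal_density\<close> is the standard deviation.\<close>

definition normal_law :: "real \<Rightarrow> real \<Rightarrow> real measure" where
  "normal_law m v =
     (if v = 0 then return borel m else density lborel (normal_density m (sqrt v)))"

text \<open>\<open>X \<sim> N(m, S)\<close>, by the usual definition of a Gaussian vector: every linear functional
  \<open>a\<^sup>T X\<close> is a real Gaussian, with mean \<open>a\<^sup>T m\<close> and variance \<open>a\<^sup>T S a\<close>. By the Cramer--Wold theorem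
  this determines the law of \<open>X\<close>.\<close>

definition multivariate_normal ::
    "'w measure \<Rightarrow> ('w \<Rightarrow> real^'n) \<Rightarrow> real^'n \<Rightarrow> real^'n^'n \<Rightarrow> bool" where
  "multivariate_normal M X m S \<longleftrightarrow>
     X \<in> borel_measurable M \<and> positive_semidefinite S \<and>
     (\<forall>a. distr M borel (\<lambda>\<omega>. a \<bullet> X \<omega>) = normal_law (a \<bullet> m) (a \<bullet> (S *v a)))"

text \<open>One iteration. The row vector \<open>z\<^sup>T A\<close> is \<open>z v* A\<close>, and \<open>\<eta>\<^sup>T B\<^sup>T\<close> is \<open>h v* transpose B\<close>. If the
  denominator vanishes the step leaves \<open>X\<close> unchanged, since division by zero yields zero; for
  the Gaussian vectors considered here this is a null event.\<close>

definition gauss_step ::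
    "real^'m^'p \<Rightarrow> real^'q^'n \<Rightarrow> real^'q^'p \<Rightarrow> real^'p \<Rightarrow> real^'q \<Rightarrow> real^'n^'m \<Rightarrow> real^'n^'m" where
  "gauss_step A B C z h X =
     X + ((z \<bullet> (C *v h) - z \<bullet> ((A ** X ** B) *v h)) / ((norm (z v* A))\<^sup>2 * (norm (B *v h))\<^sup>2))
           *\<^sub>R outer (transpose A *v z) (h v* transpose B)"

primrec gauss_iter ::
    "real^'m^'p \<Rightarrow> real^'q^'n \<Rightarrow> real^'q^'p \<Rightarrow> (nat \<Rightarrow> 'w \<Rightarrow> real^'p) \<Rightarrow> (nat \<Rightarrow> 'w \<Rightarrow> real^'q)
      \<Rightarrow> real^'n^'m \<Rightarrow> nat \<Rightarrow> 'w \<Rightarrow> real^'n^'m" where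
  "gauss_iter A B C \<zeta> \<eta> X0 0 = (\<lambda>\<omega>. X0)"
| "gauss_iter A B C \<zeta> \<eta> X0 (Suc k) =
     (\<lambda>\<omega>. gauss_step A B C (\<zeta> k \<omega>) (\<eta> k \<omega>) (gauss_iter A B C \<zeta> \<eta> X0 k \<omega>))"

end

theory Submission
  imports Defs
begin

text \<open>With \<open>u = A\<^sup>T \<zeta>\<close>, \<open>v = B \<eta>\<close> and \<open>W = u v\<^sup>T\<close>, one iteration removes from the error \<open>E\<close> its orthogonal
  projection onto \<open>W\<close>, so \<open>\<parallel>E\<parallel>\<^sup>2\<close> drops by \<open>(u\<^sup>T E v)\<^sup>2 / (\<parallel>u\<parallel>\<^sup>2 \<parallel>v\<parallel>\<^sup>2)\<close>. For \<open>u \<sim> N(0, \<Omega>)\<close>, Cauchy--Schwarz and the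
  first absolute moment of a Gaussian give \<open>E ((a \<bullet> u)\<^sup>2 / \<parallel>u\<parallel>\<^sup>2) \<ge> (2 / \<pi>) a\<^sup>T \<Omega> a / Tr \<Omega>\<close>. Averaging first
  over \<open>v\<close> and then over \<open>u\<close>, both independent of the current error, yields the contraction factor
  with \<open>\<lambda>\<^sub>m\<^sub>i\<^sub>n(\<Omega>\<^sub>1) \<lambda>\<^sub>m\<^sub>i\<^sub>n(\<Omega>\<^sub>2)\<close>, an eigenvalue of the Kronecker product.\<close>

section \<open>Rank-one matrices, the Frobenius inner product and projection onto a line\<close>

lemma inner_outer: "E \<bullet> outer u v = u \<bullet> (E *v v)"
  unfolding inner_vec_def outer_def matrix_vector_mult_def
  by (simp add: sum_distrib_left mult_ac)

lemma norm_outer: "norm (outer u v) = norm u * norm v"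
proof -
  have "(norm (outer u v))\<^sup>2 = (norm u * norm v)\<^sup>2"
    unfolding power_mult_distrib norm_matrix_eq_frobenius
    by (simp add: outer_def norm_vec_def L2_set_def sum_nonneg sum_product power_mult_distrib)
  then show ?thesis
    by simp
qed

text \<open>Bilinearity with constant 1 gives joint continuity of \<open>outer\<close>, and through
  it measurability of the random rank-one directions.\<close>

lemma bounded_bilinear_outer: "bounded_bilinear outer"
proof
  show "\<exists>K. \<forall>a b. norm (outer a b) \<le> norm a * norm b * K"
    by (intro exI[of _ 1]) (simp add: norm_outer)
qed (simp_all add: outer_def vec_eq_iff algebra_simps)

lemma borel_measurable_outer [measurable (raw)]:
  assumes "f \<in> borel_measurable M" and "g \<in> borel_measurable M"
  shows "(\<lambda>x. outer (f x) (g x)) \<in> borel_measurable M"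
  using assms
  by (rule borel_measurable_continuous_Pair)
     (intro bounded_bilinear.continuous_on[OF bounded_bilinear_outer] continuous_intros)

text \<open>Splits a matrix into its columns, so that an estimate for a fixed vector against
  \<open>U\<close> can be summed to one for a matrix.\<close>

lemma norm_matrix_columns:
  fixes E :: "real^'n^'m"
  shows "(norm E)\<^sup>2 = (\<Sum>j\<in>UNIV. (norm (column j E))\<^sup>2)"
proof -
  have "(norm E)\<^sup>2 = (\<Sum>i\<in>UNIV. \<Sum>j\<in>UNIV. (E $ i $ j)\<^sup>2)"
    unfolding norm_matrix_eq_frobenius by (simp add: sum_nonneg)
  also have "\<dots> = (\<Sum>j\<in>UNIV. \<Sum>i\<in>UNIV. (E $ i $ j)\<^sup>2)"
    by (rule sum.swap)
  also have "\<dots> = (\<Sum>j\<in>UNIV. (norm (column j E))\<^sup>2)"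
    by (simp add: norm_vec_def L2_set_def sum_nonneg column_def)
  finally show ?thesis .
qed

text \<open>Cauchy--Schwarz; for \<open>y = 0\<close> the quotient is 0 by the division convention.
  It serves as the uniform bound behind every integrability claim about projection
  quotients.\<close>

lemma inner_square_le:
  fixes x y :: "'a::real_inner"
  shows "(x \<bullet> y)\<^sup>2 / (norm y)\<^sup>2 \<le> (norm x)\<^sup>2"
proof (cases "y = 0")
  case False
  have "(x \<bullet> y)\<^sup>2 \<le> (norm x)\<^sup>2 * (norm y)\<^sup>2"
    using Cauchy_Schwarz_ineq[of x y] by (simp add: power2_norm_eq_inner)
  then show ?thesis
    using False by (simp add: divide_le_eq)
qed simp

text \<open>Pythagoras for the component of \<open>x\<close> orthogonal to \<open>y\<close>. For
  \<open>y = 0\<close> both sides collapse to the squared norm of \<open>x\<close>, so vanishing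
  directions need no exceptional event.\<close>

lemma norm_projection_residual:
  fixes x y :: "'a::real_inner"
  shows "(norm (x - ((x \<bullet> y) / (norm y)\<^sup>2) *\<^sub>R y))\<^sup>2 = (norm x)\<^sup>2 - (x \<bullet> y)\<^sup>2 / (norm y)\<^sup>2"
proof (cases "y = 0")
  case False
  then have "y \<bullet> y \<noteq> 0" by simp
  then show ?thesis
    unfolding power2_norm_eq_inner
    by (simp add: inner_diff_left inner_diff_right inner_commute power2_eq_square)
qed simp

section \<open>Eigenvalues of symmetric matrices and of Kronecker products\<close>

lemma symmetric_inner_commute:
  fixes S :: "real^'n^'n"
  assumes "transpose S = S"
  shows "x \<bullet> (S *v y) = (S *v x) \<bullet> y"
  by (metis assms dot_lmul_matrix transpose_matrix_vector)

text \<open>Eigenvectors chosen for distinct eigenvalues are orthogonal, hence independent, and a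
  finite-dimensional space holds only finitely many. Finiteness makes the \<open>Min\<close> in
  \<open>lambda_min\<close> a true lower bound of the eigenvalues.\<close>

lemma finite_eigenvalues_symmetric:
  fixes S :: "real^'n^'n"
  assumes sym: "transpose S = S"
  shows "finite (eigenvalues S)"
proof -
  define f where "f l = (SOME v. v \<noteq> 0 \<and> S *v v = l *\<^sub>R v)" for l
  have f: "f l \<noteq> 0 \<and> S *v f l = l *\<^sub>R f l" if "l \<in> eigenvalues S" for l
    unfolding f_def by (rule someI_ex) (use that in \<open>auto simp: eigenvalues_def\<close>)
  have orth: "f l \<bullet> f m = 0" if "l \<in> eigenvalues S" "m \<in> eigenvalues S" "l \<noteq> m" for l m
  proof -
    have "m * (f l \<bullet> f m) = l * (f l \<bullet> f m)"
      using symmetric_inner_commute[OF sym, of "f l" "f m"] f that by simp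
    then show ?thesis using that by simp
  qed
  have inj: "inj_on f (eigenvalues S)"
    by (rule inj_onI) (metis f inner_eq_zero_iff orth)
  have "pairwise orthogonal (f ` eigenvalues S)"
    by (auto simp: pairwise_def orthogonal_def intro: orth)
  moreover have "0 \<notin> f ` eigenvalues S"
    using f by force
  ultimately have "independent (f ` eigenvalues S)"
    by (rule pairwise_orthogonal_independent)
  then have "finite (f ` eigenvalues S)"
    using independent_bound by blast
  then show ?thesis
    using finite_imageD inj by blast
qed

text \<open>The quadratic form attains its minimum on the compact unit sphere. The minimum value
  \<open>l\<close> bounds the Rayleigh quotient from below, and the minimiser is an eigenvector
  because the residual \<open>w = S *v v - l *\<^sub>R v\<close> must vanish.\<close>

lemma symmetric_min_eigenvector:
  fixes S :: "real^'n^'n"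
  assumes sym: "transpose S = S"
  obtains l v where "v \<noteq> 0" "S *v v = l *\<^sub>R v" "\<And>x. l * (x \<bullet> x) \<le> x \<bullet> (S *v x)"
proof -
  let ?q = "\<lambda>x::real^'n. x \<bullet> (S *v x)"
  have cont: "continuous_on (sphere 0 1) ?q"
    by (intro continuous_intros linear_continuous_on_compose matrix_vector_mul_linear)
  have "axis undefined 1 \<in> sphere (0::real^'n) 1"
    by (simp add: norm_axis_1)
  then obtain v where v: "v \<in> sphere 0 1" and min: "\<And>y. y \<in> sphere 0 1 \<Longrightarrow> ?q v \<le> ?q y"
    using continuous_attains_inf[OF compact_sphere _ cont] by blast
  define l where "l = ?q v"
  have vv: "v \<bullet> v = 1" using v by (simp add: norm_eq_1)
  have le: "l * (x \<bullet> x) \<le> ?q x" for x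
  proof (cases "x = 0")
    case False
    have "l \<le> ?q ((1 / norm x) *\<^sub>R x)"
      unfolding l_def by (rule min) (use False in simp)
    also have "\<dots> = ?q x / (x \<bullet> x)"
      by (simp add: matrix_vector_mult_scaleR power2_norm_eq_inner[symmetric] power2_eq_square)
    finally show ?thesis
      using False by (simp add: field_simps)
  qed simp
  define w where "w = S *v v - l *\<^sub>R v"
  have vw: "v \<bullet> w = 0"
    by (simp add: w_def inner_diff_right vv l_def)
  define b where "b = ?q w - l * (w \<bullet> w)"
  \<comment> \<open>Compare the quadratic form at the minimiser \<open>v\<close> with its value at \<open>v - t w\<close>.\<close>
  have quad: "0 \<le> t\<^sup>2 * b - 2 * t * (w \<bullet> w)" for t
  proof -
    have Sv: "S *v v = w + l *\<^sub>R v" by (simp add: w_def)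
    have wSv: "w \<bullet> (S *v v) = w \<bullet> w"
      unfolding Sv by (simp add: inner_add_right inner_commute[of w v] vw)
    have vSw: "v \<bullet> (S *v w) = w \<bullet> w"
      using symmetric_inner_commute[OF sym, of v w] wSv by (simp add: inner_commute)
    have "?q (v - t *\<^sub>R w) = l - 2 * t * (w \<bullet> w) + t\<^sup>2 * ?q w"
      by (simp add: matrix_vector_mult_diff_distrib matrix_vector_mult_scaleR inner_diff_left
          inner_diff_right wSv vSw l_def power2_eq_square algebra_simps)
    moreover have "(v - t *\<^sub>R w) \<bullet> (v - t *\<^sub>R w) = 1 + t\<^sup>2 * (w \<bullet> w)"
      by (simp add: inner_diff_left inner_diff_right vv vw inner_commute[of w v] power2_eq_square)
    ultimately show ?thesis
      using le[of "v - t *\<^sub>R w"] by (simp add: b_def algebra_simps)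
  qed
  have "w \<bullet> w = 0"
  proof (rule ccontr)
    assume "w \<bullet> w \<noteq> 0"
    then have pos: "0 < w \<bullet> w" by simp
    have b: "0 \<le> b" using le[of w] by (simp add: b_def)
    \<comment> \<open>A small enough step makes the linear term win: \<open>t * b\<close> stays
      below \<open>w \<bullet> w\<close>, whereas \<open>quad\<close> demands at least twice that.
      The \<open>+ 1\<close> covers \<open>b = 0\<close>.\<close>
    define t where "t = (w \<bullet> w) / (b + 1)"
    have t: "0 < t" using pos b by (simp add: t_def)
    have "2 * (w \<bullet> w) \<le> t * b"
      using quad[of t] t by (simp add: power2_eq_square mult.assoc)
    also have "\<dots> \<le> w \<bullet> w"
      using b pos by (simp add: t_def field_simps)
    finally show False using pos by simp
  qed
  then have "S *v v = l *\<^sub>R v" by (simp add: w_def)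
  moreover have "v \<noteq> 0" using vv by auto
  ultimately show ?thesis using le that by blast
qed

text \<open>The vector is the tensor product of \<open>v\<close> and \<open>w\<close>; the double
  sum over pairs of indices factors into the two eigenvalue equations.\<close>

lemma kronecker_mult_eigenvectors:
  fixes S :: "real^'a^'a" and T :: "real^'b^'b"
  assumes "S *v v = l *\<^sub>R v" and "T *v w = m *\<^sub>R w"
  shows "kronecker S T *v (\<chi> i. v $ fst i * w $ snd i) = (l * m) *\<^sub>R (\<chi> i. v $ fst i * w $ snd i)"
proof -
  have S: "(\<Sum>j\<in>UNIV. S $ i $ j * v $ j) = l * v $ i" for i
    using arg_cong[OF assms(1), of "\<lambda>x. x $ i"] by (simp add: matrix_vector_mult_def)
  have T: "(\<Sum>j\<in>UNIV. T $ i $ j * w $ j) = m * w $ i" for i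
    using arg_cong[OF assms(2), of "\<lambda>x. x $ i"] by (simp add: matrix_vector_mult_def)
  have "(\<Sum>c\<in>UNIV. S $ i $ fst c * T $ k $ snd c * (v $ fst c * w $ snd c))
      = (\<Sum>j\<in>UNIV. S $ i $ j * v $ j) * (\<Sum>j\<in>UNIV. T $ k $ j * w $ j)" for i k
    by (simp add: sum_product sum.cartesian_product case_prod_beta mult_ac)
  then have "(\<Sum>c\<in>UNIV. S $ i $ fst c * T $ k $ snd c * (v $ fst c * w $ snd c))
      = l * m * (v $ i * w $ k)" for i k
    by (simp add: S T)
  then show ?thesis
    by (simp add: vec_eq_iff matrix_vector_mult_def kronecker_def)
qed

text \<open>The product \<open>l * m\<close> is itself an eigenvalue of the Kronecker product, with
  the tensor of \<open>v\<close> and \<open>w\<close> as nonzero eigenvector. This lets a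
  contraction rate obtained with \<open>l * m\<close> be weakened to the one with
  \<open>lambda_min\<close>.\<close>

lemma lambda_min_kronecker_le:
  fixes S :: "real^'a^'a" and T :: "real^'b^'b"
  assumes "transpose S = S" "transpose T = T"
    and "v \<noteq> 0" "S *v v = l *\<^sub>R v" and "w \<noteq> 0" "T *v w = m *\<^sub>R w"
  shows "lambda_min (kronecker S T) \<le> l * m"
proof -
  have "transpose (kronecker S T) = kronecker (transpose S) (transpose T)"
    by (simp add: vec_eq_iff transpose_def kronecker_def)
  then have "finite (eigenvalues (kronecker S T))"
    by (intro finite_eigenvalues_symmetric) (simp add: assms)
  moreover obtain i j where "v $ i \<noteq> 0" "w $ j \<noteq> 0"
    using assms by (auto simp: vec_eq_iff)
  then have "(\<chi> i. v $ fst i * w $ snd i) \<noteq> (0 :: real^('a \<times> 'b))"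
    by (auto simp: vec_eq_iff)
  then have "l * m \<in> eigenvalues (kronecker S T)"
    using kronecker_mult_eigenvectors[OF assms(4,6)] by (auto simp: eigenvalues_def)
  ultimately show ?thesis
    by (simp add: lambda_min_def)
qed

lemma positive_semidefinite_diag_nonneg:
  assumes "positive_semidefinite S"
  shows "0 \<le> S $ i $ i"
proof -
  have "0 \<le> axis i 1 \<bullet> (S *v axis i 1)"
    using assms unfolding positive_semidefinite_def by blast
  then show ?thesis
    by (simp add: matrix_vector_mult_basis column_def inner_axis')
qed

text \<open>A unit coordinate vector turns the hypothesis into a bound by one diagonal entry
  (\<open>undefined\<close> is just some index), and the remaining entries are nonnegative. It is
  used to show \<rho> \<ge> 0.\<close>

lemma rayleigh_bound_le_trace:
  assumes psd: "positive_semidefinite S" and "\<And>x. l * (x \<bullet> x) \<le> x \<bullet> (S *v x)"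
  shows "l \<le> trace S"
proof -
  have "l \<le> S $ undefined $ undefined"
    using assms(2)[of "axis undefined 1"]
    by (simp add: matrix_vector_mult_basis column_def inner_axis')
  also have "\<dots> \<le> trace S"
    unfolding trace_def
    by (rule member_le_sum) (simp_all add: positive_semidefinite_diag_nonneg[OF psd])
  finally show ?thesis .
qed

section \<open>Gaussian vectors: linear images and moments\<close>

lemma borel_measurable_matrix_vector_mult:
  fixes L :: "real^'n^'m"
  assumes "f \<in> borel_measurable M"
  shows "(\<lambda>\<omega>. L *v f \<omega>) \<in> borel_measurable M"
  using linear_continuous_on[OF matrix_vector_mul_bounded_linear] assms
  by (rule borel_measurable_continuous_on)

text \<open>A functional \<open>a\<close> of the image is the functional \<open>a v* L\<close> of
  \<open>X\<close>, so the definition by linear functionals carries over directly.\<close>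

lemma multivariate_normal_linear_image:
  fixes L :: "real^'n^'m"
  assumes X: "multivariate_normal M X m S"
  shows "multivariate_normal M (\<lambda>\<omega>. L *v X \<omega>) (L *v m) (L ** S ** transpose L)"
proof -
  have meas: "X \<in> borel_measurable M" and psd: "positive_semidefinite S"
    and law: "\<And>a. distr M borel (\<lambda>\<omega>. a \<bullet> X \<omega>) = normal_law (a \<bullet> m) (a \<bullet> (S *v a))"
    using X by (auto simp: multivariate_normal_def)
  have adj: "a \<bullet> (L *v x) = (a v* L) \<bullet> x" for a x
    by (simp add: dot_lmul_matrix)
  have form: "a \<bullet> ((L ** S ** transpose L) *v a) = (a v* L) \<bullet> (S *v (a v* L))" for a
    by (simp add: adj matrix_vector_mul_assoc[symmetric])
  have "(\<lambda>\<omega>. L *v X \<omega>) \<in> borel_measurable M"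
    by (rule borel_measurable_matrix_vector_mult) (rule meas)
  moreover have "positive_semidefinite (L ** S ** transpose L)"
    using psd unfolding positive_semidefinite_def form
    by (simp add: matrix_transpose_mul matrix_mul_assoc)
  moreover have "distr M borel (\<lambda>\<omega>. a \<bullet> (L *v X \<omega>))
      = normal_law (a \<bullet> (L *v m)) (a \<bullet> ((L ** S ** transpose L) *v a))" for a
    unfolding form unfolding adj by (rule law)
  ultimately show ?thesis
    by (simp add: multivariate_normal_def)
qed

text \<open>The point mass \<open>v = 0\<close> is treated apart. Otherwise these are the even
  moment with k = 1 and the odd absolute moment with k = 0, for standard deviation
  \<open>sqrt v\<close>. The second one is the source of the factor 2/pi in the rate.\<close>

lemma normal_law_centered_moments:
  assumes "0 \<le> v"
  shows "has_bochner_integral (normal_law 0 v) (\<lambda>x. x\<^sup>2) v"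
    and "has_bochner_integral (normal_law 0 v) (\<lambda>x. \<bar>x\<bar>) (sqrt (2 / pi) * sqrt v)"
proof -
  have zero: "has_bochner_integral (return borel 0) f (f 0)"
    if "f \<in> borel_measurable borel" for f :: "real \<Rightarrow> real"
    using that by (simp add: has_bochner_integral_iff integrable_iff_bounded nn_integral_return integral_return)
  show "has_bochner_integral (normal_law 0 v) (\<lambda>x. x\<^sup>2) v"
  proof (cases "v = 0")
    case True
    then show ?thesis using zero[of "\<lambda>x. x\<^sup>2"] by (simp add: normal_law_def)
  next
    case False
    then have "0 < sqrt v" using assms by simp
    from normal_moment_even[OF this, of 0 1] show ?thesis
      using False assms
      by (simp add: normal_law_def has_bochner_integral_density)
  qed
  show "has_bochner_integral (normal_law 0 v) (\<lambda>x. \<bar>x\<bar>) (sqrt (2 / pi) * sqrt v)"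
  proof (cases "v = 0")
    case True
    then show ?thesis using zero[of "\<lambda>x. \<bar>x\<bar>"] by (simp add: normal_law_def)
  next
    case False
    then have "0 < sqrt v" using assms by simp
    from normal_moment_abs_odd[OF this, of 0 0] show ?thesis
      using False assms
      by (simp add: normal_law_def has_bochner_integral_density mult.commute)
  qed
qed

text \<open>One-dimensional moments are pulled back along each functional; summing the second
  moments of the coordinates yields the trace.\<close>

lemma multivariate_normal_centered_moments:
  assumes X: "multivariate_normal M X 0 S"
  shows "has_bochner_integral M (\<lambda>\<omega>. (a \<bullet> X \<omega>)\<^sup>2) (a \<bullet> (S *v a))"
    and "has_bochner_integral M (\<lambda>\<omega>. \<bar>a \<bullet> X \<omega>\<bar>) (sqrt (2 / pi) * sqrt (a \<bullet> (S *v a)))"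
    and "has_bochner_integral M (\<lambda>\<omega>. (norm (X \<omega>))\<^sup>2) (trace S)"
proof -
  have [measurable]: "X \<in> borel_measurable M"
    and law: "\<And>a. distr M borel (\<lambda>\<omega>. a \<bullet> X \<omega>) = normal_law 0 (a \<bullet> (S *v a))"
    and nonneg: "\<And>a. 0 \<le> a \<bullet> (S *v a)"
    using X by (auto simp: multivariate_normal_def positive_semidefinite_def)
  note moments = normal_law_centered_moments[OF nonneg, folded law]
  show square: "has_bochner_integral M (\<lambda>\<omega>. (a \<bullet> X \<omega>)\<^sup>2) (a \<bullet> (S *v a))" for a
    using moments(1)[of a] by (simp add: has_bochner_integral_iff integrable_distr_eq integral_distr)
  show "has_bochner_integral M (\<lambda>\<omega>. \<bar>a \<bullet> X \<omega>\<bar>) (sqrt (2 / pi) * sqrt (a \<bullet> (S *v a)))"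
    using moments(2)[of a] by (simp add: has_bochner_integral_iff integrable_distr_eq integral_distr)
  have "has_bochner_integral M (\<lambda>\<omega>. \<Sum>i\<in>UNIV. (axis i 1 \<bullet> X \<omega>)\<^sup>2)
      (\<Sum>i\<in>UNIV. axis i 1 \<bullet> (S *v axis i 1))"
    by (intro has_bochner_integral_sum square)
  then show "has_bochner_integral M (\<lambda>\<omega>. (norm (X \<omega>))\<^sup>2) (trace S)"
    by (simp add: trace_def inner_axis' matrix_vector_mult_basis column_def norm_vec_def L2_set_def
        sum_nonneg)
qed

section \<open>Expected projections onto independent Gaussian directions\<close>

context prob_space
begin

text \<open>The library's \<open>indep_var\<close> forces both random variables to have the same value type.\<close>

definition indep_rv :: "('a \<Rightarrow> 'b::topological_space) \<Rightarrow> ('a \<Rightarrow> 'c::topological_space) \<Rightarrow> bool" where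
  "indep_rv X Y \<longleftrightarrow> X \<in> borel_measurable M \<and> Y \<in> borel_measurable M \<and>
     distr M borel X \<Otimes>\<^sub>M distr M borel Y = distr M (borel \<Otimes>\<^sub>M borel) (\<lambda>\<omega>. (X \<omega>, Y \<omega>))"

text \<open>By Cauchy--Schwarz, \<open>E (X\<^sup>2 / Y) \<ge> (E X)\<^sup>2 / E Y\<close>; integrating the linear bound
  \<open>X\<^sup>2 / Y \<ge> 2 t X - t\<^sup>2 Y\<close> with \<open>t = E X / E Y\<close> also covers the event \<open>Y = 0\<close>.\<close>

lemma gaussian_direction_bound:
  fixes Y :: "'a \<Rightarrow> real^'n"
  assumes Y: "multivariate_normal M Y 0 S"
  shows "2 / (pi * trace S) * (a \<bullet> (S *v a)) \<le> expectation (\<lambda>\<omega>. (a \<bullet> Y \<omega>)\<^sup>2 / (norm (Y \<omega>))\<^sup>2)"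
proof (cases "trace S = 0")
  case False
  have [measurable]: "Y \<in> borel_measurable M" and nonneg: "0 \<le> a \<bullet> (S *v a)"
    using Y by (auto simp: multivariate_normal_def positive_semidefinite_def)
  define m where "m = sqrt (2 / pi) * sqrt (a \<bullet> (S *v a))"
  \<comment> \<open>This \<open>t\<close> maximises \<open>2 * t * m - t\<^sup>2 * trace S\<close>,
    with maximum \<open>m\<^sup>2 / trace S\<close>.\<close>
  define t where "t = m / trace S"
  note moments = multivariate_normal_centered_moments[OF Y]
  have le: "2 * t * \<bar>x\<bar> - t\<^sup>2 * n \<le> x\<^sup>2 / n" if "0 \<le> n" "n = 0 \<Longrightarrow> x = 0" for x n :: real
  proof (cases "n = 0")
    case False
    have "0 \<le> (\<bar>x\<bar> - t * n)\<^sup>2" by simp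
    then have "(2 * t * \<bar>x\<bar> - t\<^sup>2 * n) * n \<le> x\<^sup>2"
      by (simp add: power2_diff algebra_simps power2_eq_square)
    then show ?thesis using False that by (simp add: pos_le_divide_eq)
  qed (use that in simp)
  have int: "has_bochner_integral M (\<lambda>\<omega>. 2 * t * \<bar>a \<bullet> Y \<omega>\<bar> - t\<^sup>2 * (norm (Y \<omega>))\<^sup>2)
      (2 * t * m - t\<^sup>2 * trace S)"
    unfolding m_def
    by (intro has_bochner_integral_diff has_bochner_integral_mult_right moments)
  have "2 / (pi * trace S) * (a \<bullet> (S *v a)) = m\<^sup>2 / trace S"
    using nonneg by (simp add: m_def power_mult_distrib)
  also have "\<dots> = 2 * t * m - t\<^sup>2 * trace S"
    using False by (simp add: t_def power2_eq_square)
  also have "\<dots> = expectation (\<lambda>\<omega>. 2 * t * \<bar>a \<bullet> Y \<omega>\<bar> - t\<^sup>2 * (norm (Y \<omega>))\<^sup>2)"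
    using int by (simp add: has_bochner_integral_iff)
  also have "\<dots> \<le> expectation (\<lambda>\<omega>. (a \<bullet> Y \<omega>)\<^sup>2 / (norm (Y \<omega>))\<^sup>2)"
  proof (rule integral_mono)
    show "integrable M (\<lambda>\<omega>. (a \<bullet> Y \<omega>)\<^sup>2 / (norm (Y \<omega>))\<^sup>2)"
      by (rule integrable_const_bound[where B="(norm a)\<^sup>2"]) (simp_all add: inner_square_le)
  qed (use int in \<open>auto simp: has_bochner_integral_iff intro!: le\<close>)
  finally show ?thesis .
\<comment> \<open>For \<open>trace S = 0\<close> the left side is 0 by division by zero, and the
  right side integrates a nonnegative function.\<close>
qed simp

text \<open>Fubini on the product law: a bound that holds with the first argument frozen is
  integrated over the law of \<open>X\<close>. This takes the place of conditioning on
  \<open>X\<close>.\<close>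

lemma indep_rv_expectation_ge:
  fixes f :: "'b::topological_space \<times> 'c::topological_space \<Rightarrow> real"
  assumes indep: "indep_rv X Y"
    and f [measurable]: "f \<in> borel_measurable (borel \<Otimes>\<^sub>M borel)"
    and f_int: "integrable M (\<lambda>\<omega>. f (X \<omega>, Y \<omega>))"
    and h [measurable]: "h \<in> borel_measurable borel"
    and h_int: "integrable M (\<lambda>\<omega>. h (X \<omega>))"
    and le: "\<And>x. h x \<le> expectation (\<lambda>\<omega>. f (x, Y \<omega>))"
  shows "expectation (\<lambda>\<omega>. h (X \<omega>)) \<le> expectation (\<lambda>\<omega>. f (X \<omega>, Y \<omega>))"
proof -
  have [measurable]: "X \<in> borel_measurable M" "Y \<in> borel_measurable M"
    and joint: "distr M borel X \<Otimes>\<^sub>M distr M borel Y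
      = distr M (borel \<Otimes>\<^sub>M borel) (\<lambda>\<omega>. (X \<omega>, Y \<omega>))"
    using indep by (auto simp: indep_rv_def)
  interpret DX: prob_space "distr M borel X" by (rule prob_space_distr) simp
  interpret DY: prob_space "distr M borel Y" by (rule prob_space_distr) simp
  interpret P: pair_prob_space "distr M borel X" "distr M borel Y" ..
  have int: "integrable (distr M borel X \<Otimes>\<^sub>M distr M borel Y) f"
    unfolding joint using f_int by (simp add: integrable_distr_eq)
  have "expectation (\<lambda>\<omega>. h (X \<omega>)) = (\<integral>x. h x \<partial>distr M borel X)"
    by (simp add: integral_distr)
  also have "\<dots> \<le> (\<integral>x. (\<integral>y. f (x, y) \<partial>distr M borel Y) \<partial>distr M borel X)"
  proof (rule integral_mono)
    show "integrable (distr M borel X) h"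
      using h_int by (simp add: integrable_distr_eq)
    show "integrable (distr M borel X) (\<lambda>x. \<integral>y. f (x, y) \<partial>distr M borel Y)"
      by (rule P.integrable_fst'[OF int])
    show "h x \<le> (\<integral>y. f (x, y) \<partial>distr M borel Y)" for x
      using le[of x] by (simp add: integral_distr)
  qed
  also have "\<dots> = (\<integral>z. f z \<partial>(distr M borel X \<Otimes>\<^sub>M distr M borel Y))"
    by (rule P.integral_fst'[OF int])
  also have "\<dots> = expectation (\<lambda>\<omega>. f (X \<omega>, Y \<omega>))"
    unfolding joint by (simp add: integral_distr)
  finally show ?thesis .
qed

text \<open>The one-vector bound is applied twice, contributing 2/pi each time: to \<open>V\<close>
  against the row vector \<open>u v* E\<close> with \<open>E\<close> and \<open>U\<close> frozen,
  and to \<open>U\<close> against every column of \<open>E\<close>. Since \<open>0 \<le> m\<close>,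
  the bound for \<open>U\<close> may be multiplied by the factor from \<open>V\<close>.\<close>

lemma gaussian_outer_projection_bound:
  fixes E :: "'a \<Rightarrow> real^'n^'m"
  assumes U: "multivariate_normal M U 0 S" and V: "multivariate_normal M V 0 T"
    and indep_U: "indep_rv E U"
    and indep_V: "indep_rv (\<lambda>\<omega>. (E \<omega>, U \<omega>)) V"
    and bounded: "\<And>\<omega>. norm (E \<omega>) \<le> K"
    and l: "\<And>x. l * (x \<bullet> x) \<le> x \<bullet> (S *v x)"
    and m: "\<And>x. m * (x \<bullet> x) \<le> x \<bullet> (T *v x)" "0 \<le> m"
    and trace: "0 \<le> trace S" "0 \<le> trace T"
  shows "4 / (pi\<^sup>2 * trace T * trace S) * (l * m) * expectation (\<lambda>\<omega>. (norm (E \<omega>))\<^sup>2)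
    \<le> expectation (\<lambda>\<omega>. (E \<omega> \<bullet> outer (U \<omega>) (V \<omega>))\<^sup>2 / (norm (outer (U \<omega>) (V \<omega>)))\<^sup>2)"
proof -
  have [measurable]: "E \<in> borel_measurable M" "U \<in> borel_measurable M" "V \<in> borel_measurable M"
    using indep_U V unfolding indep_rv_def multivariate_normal_def by auto
  let ?c = "2 / (pi * trace S) * l" and ?d = "2 / (pi * trace T) * m"
  have d: "0 \<le> ?d" using m(2) trace(2) by simp
  have E2: "(norm (E \<omega>))\<^sup>2 \<le> K\<^sup>2" for \<omega>
    using bounded by (intro power_mono) auto
  have int_E: "integrable M (\<lambda>\<omega>. (norm (E \<omega>))\<^sup>2)"
    by (rule integrable_const_bound[where B="K\<^sup>2"]) (simp_all add: E2)
  have bound: "(E \<omega> \<bullet> W)\<^sup>2 / (norm W)\<^sup>2 \<le> K\<^sup>2" for \<omega> W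
    by (rule order_trans[OF inner_square_le E2])
  have S: "?c * (norm a)\<^sup>2 \<le> expectation (\<lambda>\<omega>. (a \<bullet> U \<omega>)\<^sup>2 / (norm (U \<omega>))\<^sup>2)" for a
  proof -
    have "?c * (norm a)\<^sup>2 \<le> 2 / (pi * trace S) * (a \<bullet> (S *v a))"
      unfolding power2_norm_eq_inner mult.assoc using trace by (intro mult_left_mono l) auto
    then show ?thesis using gaussian_direction_bound[OF U] by (rule order_trans)
  qed
  have T: "?d * (norm a)\<^sup>2 \<le> expectation (\<lambda>\<omega>. (a \<bullet> V \<omega>)\<^sup>2 / (norm (V \<omega>))\<^sup>2)" for a
  proof -
    have "?d * (norm a)\<^sup>2 \<le> 2 / (pi * trace T) * (a \<bullet> (T *v a))"
      unfolding power2_norm_eq_inner mult.assoc using trace by (intro mult_left_mono m) auto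
    then show ?thesis using gaussian_direction_bound[OF V] by (rule order_trans)
  qed
  \<comment> \<open>The intermediate quantity between the two averagings. Read by columns it is a
    sum of one-vector quotients in \<open>u\<close>; by \<open>r_eq\<close> it is also the squared
    norm of \<open>u v* X\<close> over that of \<open>u\<close>.\<close>
  let ?r = "\<lambda>(X :: real^'n^'m, u). \<Sum>j\<in>UNIV. (X \<bullet> outer u (axis j 1))\<^sup>2 / (norm u)\<^sup>2"
  have inner_axis_outer: "X \<bullet> outer u (axis j 1) = column j X \<bullet> u" for X :: "real^'n^'m" and u j
    by (simp add: inner_outer matrix_vector_mult_basis inner_commute)
  have r_eq: "?r (X, u) = (norm (u v* X))\<^sup>2 / (norm u)\<^sup>2" for X :: "real^'n^'m" and u
  proof -
    have "X \<bullet> outer u (axis j 1) = (u v* X) $ j" for j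
      by (simp add: inner_outer dot_lmul_matrix[symmetric] inner_axis)
    then show ?thesis
      by (simp add: norm_vec_def L2_set_def sum_nonneg sum_divide_distrib)
  qed
  have int_col: "integrable M (\<lambda>\<omega>. (E \<omega> \<bullet> outer (U \<omega>) (axis j 1))\<^sup>2 / (norm (U \<omega>))\<^sup>2)" for j
  proof (rule integrable_const_bound[where B="K\<^sup>2"])
    show "AE \<omega> in M. norm ((E \<omega> \<bullet> outer (U \<omega>) (axis j 1))\<^sup>2 / (norm (U \<omega>))\<^sup>2) \<le> K\<^sup>2"
      using bound[of _ "outer (U _) (axis j 1)"] by (simp add: norm_outer norm_axis_1)
  qed simp
  have int_r: "integrable M (\<lambda>\<omega>. ?r (E \<omega>, U \<omega>))"
    using int_col by simp
  have "?c * expectation (\<lambda>\<omega>. (norm (E \<omega>))\<^sup>2) = expectation (\<lambda>\<omega>. ?c * (norm (E \<omega>))\<^sup>2)"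
    using int_E by simp
  also have "\<dots> \<le> expectation (\<lambda>\<omega>. ?r (E \<omega>, U \<omega>))"
  proof (rule indep_rv_expectation_ge[OF indep_U])
    fix X :: "real^'n^'m"
    have int: "integrable M (\<lambda>\<omega>. (column j X \<bullet> U \<omega>)\<^sup>2 / (norm (U \<omega>))\<^sup>2)" for j
      by (rule integrable_const_bound[where B="(norm (column j X))\<^sup>2"])
         (simp_all add: inner_square_le)
    have "?c * (norm X)\<^sup>2 = (\<Sum>j\<in>UNIV. ?c * (norm (column j X))\<^sup>2)"
      by (simp only: norm_matrix_columns sum_distrib_left)
    also have "\<dots> \<le> (\<Sum>j\<in>UNIV. expectation (\<lambda>\<omega>. (column j X \<bullet> U \<omega>)\<^sup>2 / (norm (U \<omega>))\<^sup>2))"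
      by (intro sum_mono S)
    also have "\<dots> = expectation (\<lambda>\<omega>. ?r (X, U \<omega>))"
      using int by (simp add: inner_axis_outer)
    finally show "?c * (norm X)\<^sup>2 \<le> expectation (\<lambda>\<omega>. ?r (X, U \<omega>))" .
  qed (use int_r int_E in \<open>simp_all add: case_prod_beta\<close>)
  finally have step_U: "?c * expectation (\<lambda>\<omega>. (norm (E \<omega>))\<^sup>2) \<le> expectation (\<lambda>\<omega>. ?r (E \<omega>, U \<omega>))" .

  let ?f = "\<lambda>((X :: real^'n^'m, u), v). (X \<bullet> outer u v)\<^sup>2 / (norm (outer u v))\<^sup>2"
  have int_f: "integrable M (\<lambda>\<omega>. ?f ((E \<omega>, U \<omega>), V \<omega>))"
    by (rule integrable_const_bound[where B="K\<^sup>2"]) (simp_all add: bound)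
  have "?d * expectation (\<lambda>\<omega>. ?r (E \<omega>, U \<omega>)) = expectation (\<lambda>\<omega>. ?d * ?r (E \<omega>, U \<omega>))"
    by (rule integral_mult_right_zero[symmetric])
  also have "\<dots> \<le> expectation (\<lambda>\<omega>. ?f ((E \<omega>, U \<omega>), V \<omega>))"
  proof (rule indep_rv_expectation_ge[OF indep_V, where h="\<lambda>x. ?d * ?r x" and f="?f"])
    show "?f \<in> borel_measurable (borel \<Otimes>\<^sub>M borel)"
      unfolding case_prod_beta borel_prod[symmetric] by measurable
    show "(\<lambda>x. ?d * ?r x) \<in> borel_measurable borel"
      unfolding case_prod_beta borel_prod[symmetric] by measurable
    show "integrable M (\<lambda>\<omega>. ?d * ?r (E \<omega>, U \<omega>))"
      using int_r by (intro integrable_mult_right)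
    fix x :: "(real^'n^'m) \<times> (real^'m)"
    obtain X u where x: "x = (X, u)" by (cases x)
    \<comment> \<open>For frozen \<open>X\<close> and \<open>u\<close> the matrix quotient becomes
      the one-vector quotient of \<open>u v* X\<close> against \<open>v\<close>, to which the bound
      \<open>T\<close> applies.\<close>
    have f_eq: "?f ((X, u), v) = ((u v* X) \<bullet> v)\<^sup>2 / (norm v)\<^sup>2 / (norm u)\<^sup>2" for v
      by (simp add: inner_outer dot_lmul_matrix norm_outer power_mult_distrib mult.commute)
    have "?d * ?r (X, u) = ?d * (norm (u v* X))\<^sup>2 / (norm u)\<^sup>2"
      unfolding r_eq by simp
    also have "\<dots> \<le> expectation (\<lambda>\<omega>. ((u v* X) \<bullet> V \<omega>)\<^sup>2 / (norm (V \<omega>))\<^sup>2) / (norm u)\<^sup>2"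
      by (intro divide_right_mono T) simp
    also have "\<dots> = expectation (\<lambda>\<omega>. ?f ((X, u), V \<omega>))"
      unfolding f_eq by (rule integral_divide_zero[symmetric])
    finally show "?d * ?r x \<le> expectation (\<lambda>\<omega>. ?f (x, V \<omega>))"
      unfolding x .
  qed (rule int_f)
  finally have step_V: "?d * expectation (\<lambda>\<omega>. ?r (E \<omega>, U \<omega>))
      \<le> expectation (\<lambda>\<omega>. ?f ((E \<omega>, U \<omega>), V \<omega>))" .
  have "4 / (pi\<^sup>2 * trace T * trace S) * (l * m) * expectation (\<lambda>\<omega>. (norm (E \<omega>))\<^sup>2)
      = ?d * (?c * expectation (\<lambda>\<omega>. (norm (E \<omega>))\<^sup>2))"
    by (simp add: power2_eq_square[of pi] mult_ac)
  also have "\<dots> \<le> ?d * expectation (\<lambda>\<omega>. ?r (E \<omega>, U \<omega>))"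
    by (intro mult_left_mono step_U d)
  also note step_V
  finally show ?thesis by simp
qed

section \<open>Independence of quantities built from disjoint blocks of draws\<close>

lemma indep_rv_of_disjoint_generators:
  assumes indep: "indep_sets F UNIV" and stable: "\<And>i. Int_stable (F i)"
    and disj: "I \<inter> J = {}"
    and X: "X \<in> borel_measurable (sigma (space M) (\<Union>i\<in>I. F i))"
    and Y: "Y \<in> borel_measurable (sigma (space M) (\<Union>i\<in>J. F i))"
  shows "indep_rv X Y"
proof -
  \<comment> \<open>Grouping independent intersection-stable generators over disjoint index sets
    keeps the generated sigma-algebras independent. The two blocks are indexed by
    \<open>bool\<close> to match \<open>indep_set\<close>.\<close>
  have "indep_sets (\<lambda>b. sigma_sets (space M) (\<Union>i\<in>(case b of True \<Rightarrow> I | False \<Rightarrow> J). F i)) UNIV"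
  proof (rule indep_sets_collect_sigma)
    show "indep_sets F (\<Union>b. case b of True \<Rightarrow> I | False \<Rightarrow> J)"
      using indep by (rule indep_sets_mono_index[rotated]) simp
    show "disjoint_family (case_bool I J)"
      using disj by (auto simp: disjoint_family_on_def split: bool.split)
  qed (rule stable)
  then have ind: "indep_set (sigma_sets (space M) (\<Union>i\<in>I. F i)) (sigma_sets (space M) (\<Union>i\<in>J. F i))"
    unfolding indep_set_def by (rule indep_sets_mono_sets) (auto split: bool.split)
  have ev: "F i \<subseteq> events" for i
    using indep by (auto simp: indep_sets_def)
  then have sp: "(\<Union>i\<in>K. F i) \<subseteq> Pow (space M)" for K
    using sets.space_closed by blast
  have sub: "sigma_sets (space M) {Z -` A \<inter> space M | A. A \<in> sets borel}
      \<subseteq> sigma_sets (space M) (\<Union>i\<in>K. F i)"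
    and meas: "Z \<in> borel_measurable M"
    if Z: "Z \<in> borel_measurable (sigma (space M) (\<Union>i\<in>K. F i))"
    for Z :: "'a \<Rightarrow> 'z::topological_space" and K
  proof -
    have pre: "Z -` A \<inter> space M \<in> sigma_sets (space M) (\<Union>i\<in>K. F i)" if "A \<in> sets borel" for A
      using measurable_sets[OF Z that] sp[of K] by (simp add: space_measure_of_conv)
    then show "sigma_sets (space M) {Z -` A \<inter> space M | A. A \<in> sets borel}
      \<subseteq> sigma_sets (space M) (\<Union>i\<in>K. F i)"
      by (intro sigma_sets_mono) auto
    have "sigma_sets (space M) (\<Union>i\<in>K. F i) \<subseteq> events"
      using ev by (intro sets.sigma_sets_subset) auto
    then show "Z \<in> borel_measurable M"
      using pre by (intro measurableI) auto
  qed
  have [measurable]: "X \<in> borel_measurable M" "Y \<in> borel_measurable M"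
    using meas[OF X] meas[OF Y] .
  have prod: "prob ((X -` A \<inter> space M) \<inter> (Y -` B \<inter> space M))
      = prob (X -` A \<inter> space M) * prob (Y -` B \<inter> space M)"
    if "A \<in> sets borel" "B \<in> sets borel" for A B
    by (rule indep_setD[OF ind]) (use sub[OF X] sub[OF Y] that in \<open>blast intro: sigma_sets.Basic\<close>)+
  interpret DX: prob_space "distr M borel X" by (rule prob_space_distr) simp
  interpret DY: prob_space "distr M borel Y" by (rule prob_space_distr) simp
  have "distr M borel X \<Otimes>\<^sub>M distr M borel Y = distr M (borel \<Otimes>\<^sub>M borel) (\<lambda>\<omega>. (X \<omega>, Y \<omega>))"
  \<comment> \<open>The product law is determined by its values on measurable rectangles, where
    \<open>prod\<close> gives the factorisation.\<close>
  proof (rule pair_measure_eqI)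
    fix A B assume "A \<in> sets (distr M borel X)" "B \<in> sets (distr M borel Y)"
    then have [measurable]: "A \<in> sets borel" "B \<in> sets borel" by simp_all
    have "(\<lambda>\<omega>. (X \<omega>, Y \<omega>)) -` (A \<times> B) \<inter> space M
        = (X -` A \<inter> space M) \<inter> (Y -` B \<inter> space M)"
      by auto
    then show "emeasure (distr M borel X) A * emeasure (distr M borel Y) B
        = emeasure (distr M (borel \<Otimes>\<^sub>M borel) (\<lambda>\<omega>. (X \<omega>, Y \<omega>))) (A \<times> B)"
      by (simp add: emeasure_distr emeasure_eq_measure prod ennreal_mult)
  qed (simp_all add: DX.sigma_finite_measure_axioms DY.sigma_finite_measure_axioms cong: sets_pair_measure_cong)
  then show ?thesis
    by (simp add: indep_rv_def)
qed

end

section \<open>The error recursion\<close>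

lemma gauss_step_error:
  fixes A :: "real^'m^'p" and B :: "real^'q^'n"
  assumes "A ** Xstar ** B = C"
  shows "gauss_step A B C z h X - Xstar
    = (X - Xstar) - (((X - Xstar) \<bullet> outer (transpose A *v z) (B *v h))
        / (norm (outer (transpose A *v z) (B *v h)))\<^sup>2) *\<^sub>R outer (transpose A *v z) (B *v h)"
proof -
  have "z \<bullet> (C *v h) - z \<bullet> ((A ** X ** B) *v h) = - ((X - Xstar) \<bullet> outer (transpose A *v z) (B *v h))"
    unfolding assms[symmetric]
    by (simp add: inner_outer dot_lmul_matrix matrix_vector_mul_assoc[symmetric]
        matrix_vector_mult_diff_rdistrib matrix_vector_mult_diff_distrib inner_diff_right)
  then show ?thesis
    by (simp add: gauss_step_def norm_outer power_mult_distrib)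
qed

text \<open>The error after \<open>k\<close> steps depends only on the draws with index below
  \<open>k\<close>. The measure space \<open>N\<close> is arbitrary so that it can be the
  sigma-algebra generated by exactly those draws.\<close>

lemma gauss_iter_error_measurable:
  fixes A :: "real^'m^'p" and B :: "real^'q^'n"
  assumes "A ** Xstar ** B = C"
    and "\<And>j. j < k \<Longrightarrow> (\<lambda>\<omega>. transpose A *v \<zeta> j \<omega>) \<in> borel_measurable N"
    and "\<And>j. j < k \<Longrightarrow> (\<lambda>\<omega>. B *v \<eta> j \<omega>) \<in> borel_measurable N"
  shows "(\<lambda>\<omega>. gauss_iter A B C \<zeta> \<eta> X0 k \<omega> - Xstar) \<in> borel_measurable N"
  using assms(2,3)
proof (induction k)
  case (Suc k)
  have [measurable]: "(\<lambda>\<omega>. gauss_iter A B C \<zeta> \<eta> X0 k \<omega> - Xstar) \<in> borel_measurable N"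
    by (rule Suc.IH) (simp_all only: Suc.prems less_SucI)
  have [measurable]: "(\<lambda>\<omega>. outer (transpose A *v \<zeta> k \<omega>) (B *v \<eta> k \<omega>)) \<in> borel_measurable N"
    by (intro borel_measurable_outer Suc.prems) simp_all
  show ?case
    unfolding gauss_iter.simps gauss_step_error[OF assms(1)] by measurable
qed simp

theorem theorem5p1:
  fixes M :: "'w measure"
    and A :: "real^'m^'p" and B :: "real^'q^'n" and C :: "real^'q^'p"
    and Xstar X0 :: "real^'n^'m"
    and \<Sigma>1 :: "real^'p^'p" and \<Sigma>2 :: "real^'q^'q"
    and \<Omega>1 :: "real^'m^'m" and \<Omega>2 :: "real^'n^'n"
    and \<zeta> :: "nat \<Rightarrow> 'w \<Rightarrow> real^'p" and \<eta> :: "nat \<Rightarrow> 'w \<Rightarrow> real^'q"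
    and \<rho> :: real
  assumes "prob_space M"
    and "rank A = CARD('m)" and "rank B = CARD('n)"
    and "A ** Xstar ** B = C"
    and "positive_definite \<Sigma>1" and "positive_definite \<Sigma>2"
    and "\<And>k. multivariate_normal M (\<zeta> k) 0 \<Sigma>1"
    and "\<And>k. multivariate_normal M (\<eta> k) 0 \<Sigma>2"
    and "prob_space.indep_sets M
           (case_sum (\<lambda>k. {\<zeta> k -` S \<inter> space M | S. S \<in> sets borel})
                     (\<lambda>k. {\<eta> k -` S \<inter> space M | S. S \<in> sets borel})) (UNIV :: (nat + nat) set)"
    and "\<Omega>1 = transpose A ** \<Sigma>1 ** A" and "\<Omega>2 = B ** \<Sigma>2 ** transpose B"
    and "\<rho> = 1 - 4 / (pi\<^sup>2 * trace \<Omega>2 * trace \<Omega>1) * lambda_min (kronecker (transpose \<Omega>2) \<Omega>1)"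
  shows "(\<forall>k. multivariate_normal M (\<lambda>\<omega>. transpose A *v \<zeta> k \<omega>) 0 \<Omega>1 \<and>
              multivariate_normal M (\<lambda>\<omega>. B *v \<eta> k \<omega>) 0 \<Omega>2) \<and>
         (\<forall>k. integrable M (\<lambda>\<omega>. (norm (gauss_iter A B C \<zeta> \<eta> X0 k \<omega> - Xstar))\<^sup>2) \<and>
              prob_space.expectation M (\<lambda>\<omega>. (norm (gauss_iter A B C \<zeta> \<eta> X0 k \<omega> - Xstar))\<^sup>2)
                \<le> \<rho> ^ k * (norm (X0 - Xstar))\<^sup>2)"
  proof -

  \<comment> \<open>Laws of the projected draws and the contraction factor\<close>
  interpret prob_space M by fact
  define U where "U k \<omega> = transpose A *v \<zeta> k \<omega>" for k \<omega>
  define V where "V k \<omega> = B *v \<eta> k \<omega>" for k \<omega>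
  define E where "E k \<omega> = gauss_iter A B C \<zeta> \<eta> X0 k \<omega> - Xstar" for k \<omega>
  have U: "multivariate_normal M (U k) 0 \<Omega>1" for k
    using multivariate_normal_linear_image[OF assms(7)[of k], of "transpose A"]
    unfolding assms(10) U_def by (simp del: transpose_matrix_vector)
  have V: "multivariate_normal M (V k) 0 \<Omega>2" for k
    using multivariate_normal_linear_image[OF assms(8)[of k], of B]
    unfolding assms(11) V_def by simp
  have psd1: "positive_semidefinite \<Omega>1" and psd2: "positive_semidefinite \<Omega>2"
    using U V by (auto simp: multivariate_normal_def)
  then have sym1: "transpose \<Omega>1 = \<Omega>1" and sym2: "transpose \<Omega>2 = \<Omega>2"
    by (auto simp: positive_semidefinite_def)
  obtain l1 v1 where v1: "v1 \<noteq> 0" "\<Omega>1 *v v1 = l1 *\<^sub>R v1"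
    and l1: "\<And>x. l1 * (x \<bullet> x) \<le> x \<bullet> (\<Omega>1 *v x)"
    using symmetric_min_eigenvector[OF sym1] by metis
  obtain l2 v2 where v2: "v2 \<noteq> 0" "\<Omega>2 *v v2 = l2 *\<^sub>R v2"
    and l2: "\<And>x. l2 * (x \<bullet> x) \<le> x \<bullet> (\<Omega>2 *v x)"
    using symmetric_min_eigenvector[OF sym2] by metis
  have nonneg: "0 \<le> l" if "v \<noteq> 0" "S *v v = l *\<^sub>R v" "positive_semidefinite S"
    for l v and S :: "real^'z^'z"
  proof -
    have "0 \<le> v \<bullet> (S *v v)" using that(3) by (auto simp: positive_semidefinite_def)
    then have "0 \<le> l * (v \<bullet> v)" using that(2) by simp
    moreover have "0 < v \<bullet> v" using that(1) by simp
    ultimately show ?thesis by (meson mult_neg_pos not_le)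
  qed
  have l1_nonneg: "0 \<le> l1" and l2_nonneg: "0 \<le> l2"
    using nonneg[OF v1 psd1] nonneg[OF v2 psd2] .
  have l1_le: "l1 \<le> trace \<Omega>1" and l2_le: "l2 \<le> trace \<Omega>2"
    using rayleigh_bound_le_trace[OF psd1 l1] rayleigh_bound_le_trace[OF psd2 l2] .
  have t1: "0 \<le> trace \<Omega>1" and t2: "0 \<le> trace \<Omega>2"
    using l1_nonneg l1_le l2_nonneg l2_le by auto
  define c where "c = 4 / (pi\<^sup>2 * trace \<Omega>2 * trace \<Omega>1)"
  have c: "0 \<le> c" using t1 t2 by (simp add: c_def)
  \<comment> \<open>Symmetry removes the transpose. As \<open>c \<ge> 0\<close>, replacing
    \<open>l1 * l2\<close> by the possibly smaller \<open>lambda_min\<close> can only enlarge the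
    factor.\<close>
  have "lambda_min (kronecker (transpose \<Omega>2) \<Omega>1) \<le> l1 * l2"
    unfolding sym2 mult.commute[of l1]
    by (rule lambda_min_kronecker_le[OF sym2 sym1 v2 v1])
  then have rho: "1 - c * (l1 * l2) \<le> \<rho>"
    unfolding assms(12) c_def[symmetric] using c by (simp add: mult_left_mono)
  have "c * (l1 * l2) \<le> c * (trace \<Omega>1 * trace \<Omega>2)"
    using c l1_le l2_le l1_nonneg l2_nonneg by (intro mult_left_mono mult_mono) auto
  \<comment> \<open>Equality holds unless a trace is 0, in which case \<open>c = 0\<close>.\<close>
  also have "\<dots> \<le> 4 / pi\<^sup>2"
    by (simp add: c_def)
  also have "\<dots> \<le> 1"
    using power_mono[OF pi_ge_two, of 2] by (simp add: divide_le_eq)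
  finally have rho_nonneg: "0 \<le> \<rho>" using rho by simp

  \<comment> \<open>Independence of the current error from the fresh draws\<close>
  define F where "F = case_sum (\<lambda>k. {\<zeta> k -` S \<inter> space M | S. S \<in> sets borel})
                     (\<lambda>k. {\<eta> k -` S \<inter> space M | S. S \<in> sets borel})"
  have indep: "indep_sets F UNIV" using assms(9) by (simp add: F_def)
  have stable: "Int_stable (F i)" for i
  proof -
    have vimage: "Int_stable {X -` S \<inter> space M | S. S \<in> sets borel}"
      for X :: "'w \<Rightarrow> 'z::topological_space"
    proof (rule Int_stableI, clarify)
      fix S T :: "'z set"
      assume "S \<in> sets borel" "T \<in> sets borel"
      then show "\<exists>Sa. X -` S \<inter> space M \<inter> (X -` T \<inter> space M) = X -` Sa \<inter> space M \<and> Sa \<in> sets borel"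
        by (intro exI[of _ "S \<inter> T"]) auto
    qed
    show ?thesis by (cases i) (simp_all add: F_def vimage)
  qed
  have Fsp: "(\<Union>i\<in>I. F i) \<subseteq> Pow (space M)" for I
    by (auto simp: F_def split: sum.splits)
  let ?N = "\<lambda>I. sigma (space M) (\<Union>i\<in>I. F i)"
  have \<zeta>_meas: "\<zeta> k \<in> borel_measurable (?N I)" if "Inl k \<in> I" for k I
  proof (rule measurableI)
    fix S :: "(real^'p) set" assume "S \<in> sets borel"
    then have "\<zeta> k -` S \<inter> space M \<in> F (Inl k)" by (auto simp: F_def)
    then show "\<zeta> k -` S \<inter> space (?N I) \<in> sets (?N I)"
      using that Fsp[of I] by (auto simp: space_measure_of_conv)
  qed simp
  have \<eta>_meas: "\<eta> k \<in> borel_measurable (?N I)" if "Inr k \<in> I" for k I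
  proof (rule measurableI)
    fix S :: "(real^'q) set" assume "S \<in> sets borel"
    then have "\<eta> k -` S \<inter> space M \<in> F (Inr k)" by (auto simp: F_def)
    then show "\<eta> k -` S \<inter> space (?N I) \<in> sets (?N I)"
      using that Fsp[of I] by (auto simp: space_measure_of_conv)
  qed simp
  have U_meas: "U k \<in> borel_measurable (?N I)" if "Inl k \<in> I" for k I
    unfolding U_def by (rule borel_measurable_matrix_vector_mult[OF \<zeta>_meas[OF that]])
  have V_meas: "V k \<in> borel_measurable (?N I)" if "Inr k \<in> I" for k I
    unfolding V_def by (rule borel_measurable_matrix_vector_mult[OF \<eta>_meas[OF that]])
  have E_meas: "E k \<in> borel_measurable (?N I)" if "Inl ` {..<k} \<union> Inr ` {..<k} \<subseteq> I" for k I
    unfolding E_def using that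
    by (intro gauss_iter_error_measurable[OF assms(4)] U_meas[unfolded U_def] V_meas[unfolded V_def]) auto
  have indep_U: "indep_rv (E k) (U k)" for k
  proof (rule indep_rv_of_disjoint_generators[OF indep stable])
    show "(Inl ` {..<k} \<union> Inr ` {..<k}) \<inter> {Inl k} = {}" by auto
    show "E k \<in> borel_measurable (?N (Inl ` {..<k} \<union> Inr ` {..<k}))" by (rule E_meas) simp
    show "U k \<in> borel_measurable (?N {Inl k})" by (rule U_meas) simp
  qed
  have indep_V: "indep_rv (\<lambda>\<omega>. (E k \<omega>, U k \<omega>)) (V k)" for k
  proof (rule indep_rv_of_disjoint_generators[OF indep stable])
    \<comment> \<open>The left block reaches \<open>k\<close> itself because the pair contains
      \<open>U k\<close>; the right block stops before it, leaving \<open>Inr k\<close> for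
      \<open>V k\<close>.\<close>
    let ?I = "Inl ` {..<Suc k} \<union> Inr ` {..<k}"
    show "?I \<inter> {Inr k} = {}" by auto
    show "(\<lambda>\<omega>. (E k \<omega>, U k \<omega>)) \<in> borel_measurable (?N ?I)"
      by (intro borel_measurable_Pair E_meas U_meas) auto
    show "V k \<in> borel_measurable (?N {Inr k})" by (rule V_meas) simp
  qed
  have E_M [measurable]: "E k \<in> borel_measurable M" for k
    using indep_U[of k] by (simp add: indep_rv_def)
  have U_M [measurable]: "U k \<in> borel_measurable M" for k
    using U[of k] by (simp add: multivariate_normal_def)
  have V_M [measurable]: "V k \<in> borel_measurable M" for k
    using V[of k] by (simp add: multivariate_normal_def)

  \<comment> \<open>Pointwise decrease of the error and contraction in expectation\<close>
  let ?W = "\<lambda>k \<omega>. outer (U k \<omega>) (V k \<omega>)"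
  have step: "(norm (E (Suc k) \<omega>))\<^sup>2
      = (norm (E k \<omega>))\<^sup>2 - (E k \<omega> \<bullet> ?W k \<omega>)\<^sup>2 / (norm (?W k \<omega>))\<^sup>2" for k \<omega>
    unfolding E_def U_def V_def gauss_iter.simps gauss_step_error[OF assms(4)]
    by (rule norm_projection_residual)
  \<comment> \<open>The error never grows along any path, so the deterministic initial error
    dominates all later ones and gives integrability.\<close>
  have bounded: "(norm (E k \<omega>))\<^sup>2 \<le> (norm (X0 - Xstar))\<^sup>2" for k \<omega>
  proof (induction k)
    case 0
    show ?case by (simp add: E_def)
  next
    case (Suc k)
    have "(norm (E (Suc k) \<omega>))\<^sup>2 \<le> (norm (E k \<omega>))\<^sup>2"
      unfolding step by simp
    then show ?case using Suc by simp
  qed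
  then have bounded': "norm (E k \<omega>) \<le> norm (X0 - Xstar)" for k \<omega>
    by (meson norm_ge_zero power2_le_imp_le)
  have int_E: "integrable M (\<lambda>\<omega>. (norm (E k \<omega>))\<^sup>2)" for k
    by (rule integrable_const_bound[where B="(norm (X0 - Xstar))\<^sup>2"]) (simp_all add: bounded)
  have int_W: "integrable M (\<lambda>\<omega>. (E k \<omega> \<bullet> ?W k \<omega>)\<^sup>2 / (norm (?W k \<omega>))\<^sup>2)" for k
    by (rule integrable_const_bound[where B="(norm (X0 - Xstar))\<^sup>2"])
       (auto intro!: AE_I2 order_trans[OF inner_square_le bounded])
  have "expectation (\<lambda>\<omega>. (norm (E k \<omega>))\<^sup>2) \<le> \<rho> ^ k * (norm (X0 - Xstar))\<^sup>2" for k
  proof (induction k)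
    case 0
    show ?case by (simp add: E_def prob_space)
  next
    case (Suc k)
    have "expectation (\<lambda>\<omega>. (norm (E (Suc k) \<omega>))\<^sup>2)
        = expectation (\<lambda>\<omega>. (norm (E k \<omega>))\<^sup>2)
          - expectation (\<lambda>\<omega>. (E k \<omega> \<bullet> ?W k \<omega>)\<^sup>2 / (norm (?W k \<omega>))\<^sup>2)"
      unfolding step by (rule Bochner_Integration.integral_diff[OF int_E int_W])
    also have "\<dots> \<le> (1 - c * (l1 * l2)) * expectation (\<lambda>\<omega>. (norm (E k \<omega>))\<^sup>2)"
      using gaussian_outer_projection_bound[OF U V indep_U indep_V bounded' l1 l2 l2_nonneg t1 t2]
      by (simp add: c_def[symmetric] left_diff_distrib)
    also have "\<dots> \<le> \<rho> * expectation (\<lambda>\<omega>. (norm (E k \<omega>))\<^sup>2)"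
      by (intro mult_right_mono rho) simp
    \<comment> \<open>Here \<rho> \<ge> 0 is essential: the induction hypothesis is multiplied by
      it.\<close>
    also have "\<dots> \<le> \<rho> * (\<rho> ^ k * (norm (X0 - Xstar))\<^sup>2)"
      by (intro mult_left_mono Suc.IH rho_nonneg)
    finally show ?case by (simp add: mult.assoc)
  qed
  then show ?thesis
    using U V int_E unfolding U_def V_def E_def by blast
qed

end
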